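(* Suppose $\mathrm{Ker}_1\phi=0$ and $\dim\bar D=\infty$. Let $\sigma\in D^*$ and $c,c'\in\mathbb C$. Then (1) $\Gamma(V^c,\sigma)\cong\Gamma(V^{c'},\sigma)$ as $W$-modules if and only if $c=c'$; (2) if $\sigma\in G$, then no two of the modules $\Gamma(V^c,\sigma)$, $\Gamma(\sigma,1)$, $\Gamma(\sigma,\infty)$ are isomorphic as $W$-modules.
   Context: Let $G$ be a nonzero abelian group, $D$ a complex vector space, $\phi:G\times D\to\mathbb C$ additive in the first variable and $\mathbb C$-linear in the second; write $d(a)=a(d)=\phi(a,d)$. $\mathrm{Ker}_1\phi=\{a\in G\mid\phi(a,D)=0\}$, $\mathrm{Ker}_2\phi=\{d\in D\mid\phi(G,d)=0\}$, and $\bar D$ is a fixed complement: $D=\bar D\oplus\mathrm{Ker}_2\phi$. When $\mathrm{Ker}_1\phi=0$, $G$ is identified with a subgroup of $D^*$ via $a\mapsto\phi(a,-)$. Let $A=\mathbb C[G]$ with basis $t^a$. The generalized Witt algebra $W=A\otimes_{\mathbb C}D$ has bracket $[t^ad,t^{a'}d']=t^{a+a'}(\phi(a',d)d'-\phi(a,d')d)$, where $t^ad=t^a\otimes d$. For $c\in\mathbb C$ and $\sigma\in D^*$, let $V^c=\mathbb Cv$ and let $\Gamma(V^c,\sigma)=A\otimes V^c$ be the $W$-module with $t^ad\cdot(t^b\otimes v)=(d(b)+\sigma(d)+c\,\phi(a,d))\,t^{a+b}\otimes v$. For $\sigma\in G$, $\Gamma(\sigma,1)=\Gamma(V^0,\sigma)/(\mathbb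 Ct^{-\sigma}\otimes V^0)$ and $\Gamma(\sigma,\infty)=\bigoplus_{a\in G,a\ne-\sigma}\mathbb Ct^a\otimes V^1\subset\Gamma(V^1,\sigma)$. *)

theory Defs
  imports "HOL-Library.Poly_Mapping" "HOL-Algebra.Algebraic_Closure_Type"
begin

section \<open>Lie algebras and their modules\<close>

text \<open>
  A Lie algebra over \<open>R\<close> is a module over \<open>R\<close> in the sense of HOL-Algebra whose
  \<open>mult\<close> field holds the Lie bracket; the field \<open>one\<close> is ignored.
\<close>

locale lie_algebra = Module.module R L for R (structure) and L (structure) +
  assumes bracket_closed:
      "\<lbrakk>x \<in> carrier L; y \<in> carrier L\<rbrakk> \<Longrightarrow> x \<otimes>\<^bsub>L\<^esub> y \<in> carrier L"
    and bracket_add_left: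
      "\<lbrakk>x \<in> carrier L; y \<in> carrier L; z \<in> carrier L\<rbrakk>
        \<Longrightarrow> (x \<oplus>\<^bsub>L\<^esub> y) \<otimes>\<^bsub>L\<^esub> z = x \<otimes>\<^bsub>L\<^esub> z \<oplus>\<^bsub>L\<^esub> y \<otimes>\<^bsub>L\<^esub> z"
    and bracket_add_right:
      "\<lbrakk>x \<in> carrier L; y \<in> carrier L; z \<in> carrier L\<rbrakk>
        \<Longrightarrow> z \<otimes>\<^bsub>L\<^esub> (x \<oplus>\<^bsub>L\<^esub> y) = z \<otimes>\<^bsub>L\<^esub> x \<oplus>\<^bsub>L\<^esub> z \<otimes>\<^bsub>L\<^esub> y"
    and bracket_smult_left:
      "\<lbrakk>k \<in> carrier R; x \<in> carrier L; y \<in> carrier L\<rbrakk>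
        \<Longrightarrow> (k \<odot>\<^bsub>L\<^esub> x) \<otimes>\<^bsub>L\<^esub> y = k \<odot>\<^bsub>L\<^esub> (x \<otimes>\<^bsub>L\<^esub> y)"
    and bracket_smult_right:
      "\<lbrakk>k \<in> carrier R; x \<in> carrier L; y \<in> carrier L\<rbrakk>
        \<Longrightarrow> x \<otimes>\<^bsub>L\<^esub> (k \<odot>\<^bsub>L\<^esub> y) = k \<odot>\<^bsub>L\<^esub> (x \<otimes>\<^bsub>L\<^esub> y)"
    and bracket_self: "x \<in> carrier L \<Longrightarrow> x \<otimes>\<^bsub>L\<^esub> x = \<zero>\<^bsub>L\<^esub>"
    and jacobi:
      "\<lbrakk>x \<in> carrier L; y \<in> carrier L; z \<in> carrier L\<rbrakk>
        \<Longrightarrow> x \<otimes>\<^bsub>L\<^esub> (y \<otimes>\<^bsub>L\<^esub> z) \<oplus>\<^bsub>L\<^esub> y \<otimes>\<^bsub>L\<^esub> (z \<otimes>\<^bsub>L\<^esub> x) \<oplus>\<^bsub>L\<^esub> z \<otimes>\<^bsub>L\<^esub> (x \<otimes>\<^bsub>L\<^esub> y) = \<zero>\<^bsub>L\<^esub>"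

text \<open>
  The underlying vector space of a Lie module is again a HOL-Algebra module, whose \<open>mult\<close> and
  \<open>one\<close> fields are ignored.
\<close>

record ('a, 'm, 'w) lie_mod = "('a, 'm) module" +
  act :: "'w \<Rightarrow> 'm \<Rightarrow> 'm"

locale lie_module = L: lie_algebra R L + Module.module R M
  for R (structure) and L :: "('a, 'w, 'l) module_scheme" (structure)
    and M :: "('a, 'm, 'w) lie_mod" (structure) +
  assumes act_closed:
      "\<lbrakk>x \<in> carrier L; m \<in> carrier M\<rbrakk> \<Longrightarrow> act M x m \<in> carrier M"
    and act_add_left:
      "\<lbrakk>x \<in> carrier L; y \<in> carrier L; m \<in> carrier M\<rbrakk>
        \<Longrightarrow> act M (x \<oplus>\<^bsub>L\<^esub> y) m = act M x m \<oplus>\<^bsub>M\<^esub> act M y m"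
    and act_add_right:
      "\<lbrakk>x \<in> carrier L; m \<in> carrier M; n \<in> carrier M\<rbrakk>
        \<Longrightarrow> act M x (m \<oplus>\<^bsub>M\<^esub> n) = act M x m \<oplus>\<^bsub>M\<^esub> act M x n"
    and act_smult_left:
      "\<lbrakk>k \<in> carrier R; x \<in> carrier L; m \<in> carrier M\<rbrakk>
        \<Longrightarrow> act M (k \<odot>\<^bsub>L\<^esub> x) m = k \<odot>\<^bsub>M\<^esub> act M x m"
    and act_smult_right:
      "\<lbrakk>k \<in> carrier R; x \<in> carrier L; m \<in> carrier M\<rbrakk>
        \<Longrightarrow> act M x (k \<odot>\<^bsub>M\<^esub> m) = k \<odot>\<^bsub>M\<^esub> act M x m"
    and act_bracket:
      "\<lbrakk>x \<in> carrier L; y \<in> carrier L; m \<in> carrier M\<rbrakk>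
        \<Longrightarrow> act M (x \<otimes>\<^bsub>L\<^esub> y) m = act M x (act M y m) \<ominus>\<^bsub>M\<^esub> act M y (act M x m)"

locale lie_submodule = lie_module R L M + additive_subgroup N M
  for R (structure) and L (structure) and N and M (structure) +
  assumes submodule_smult_closed:
      "\<lbrakk>k \<in> carrier R; n \<in> N\<rbrakk> \<Longrightarrow> k \<odot>\<^bsub>M\<^esub> n \<in> N"
    and submodule_act_closed:
      "\<lbrakk>x \<in> carrier L; n \<in> N\<rbrakk> \<Longrightarrow> act M x n \<in> N"

definition lie_module_hom ::
  "('a, 'k) ring_scheme \<Rightarrow> ('a, 'w, 'l) module_scheme \<Rightarrow>
   ('a, 'm, 'w) lie_mod \<Rightarrow> ('a, 'n, 'w) lie_mod \<Rightarrow> ('m \<Rightarrow> 'n) set" where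
  "lie_module_hom R L M N = {f \<in> carrier M \<rightarrow> carrier N.
     (\<forall>m\<in>carrier M. \<forall>m'\<in>carrier M. f (m \<oplus>\<^bsub>M\<^esub> m') = f m \<oplus>\<^bsub>N\<^esub> f m') \<and>
     (\<forall>k\<in>carrier R. \<forall>m\<in>carrier M. f (k \<odot>\<^bsub>M\<^esub> m) = k \<odot>\<^bsub>N\<^esub> f m) \<and>
     (\<forall>x\<in>carrier L. \<forall>m\<in>carrier M. f (act M x m) = act N x (f m))}"

definition lie_module_isomorphic ::
  "('a, 'k) ring_scheme \<Rightarrow> ('a, 'w, 'l) module_scheme \<Rightarrow>
   ('a, 'm, 'w) lie_mod \<Rightarrow> ('a, 'n, 'w) lie_mod \<Rightarrow> bool" where
  "lie_module_isomorphic R L M N \<longleftrightarrow>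
     (\<exists>f \<in> lie_module_hom R L M N. bij_betw f (carrier M) (carrier N))"

text \<open>
  Elements of the quotient are cosets; scalars and Lie algebra elements act through any
  representative (the union below is over equal cosets).
\<close>

definition quotient_lie_mod :: "('a, 'm, 'w) lie_mod \<Rightarrow> 'm set \<Rightarrow> ('a, 'm set, 'w) lie_mod" where
  "quotient_lie_mod M N =
     \<lparr>carrier = a_rcosets\<^bsub>M\<^esub> N, monoid.mult = undefined, one = undefined,
      zero = N, add = set_add M,
      module.smult = (\<lambda>k C. \<Union>m\<in>C. N +>\<^bsub>M\<^esub> (k \<odot>\<^bsub>M\<^esub> m)),
      act = (\<lambda>x C. \<Union>m\<in>C. N +>\<^bsub>M\<^esub> act M x m)\<rparr>"


section \<open>The pairing\<close>

locale witt_datum = vector_space scale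
  for scale :: "complex \<Rightarrow> 'd::ab_group_add \<Rightarrow> 'd" +
  fixes \<phi> :: "'g::ab_group_add \<Rightarrow> 'd \<Rightarrow> complex"
  assumes group_nonzero: "\<exists>a::'g. a \<noteq> 0"
    and phi_add: "\<phi> (a + b) d = \<phi> a d + \<phi> b d"
    and phi_linear: "Vector_Spaces.linear scale (*) (\<phi> a)"

definition Ker1 :: "('g \<Rightarrow> 'd \<Rightarrow> complex) \<Rightarrow> 'g set" where
  "Ker1 \<phi> = {a. \<forall>d. \<phi> a d = 0}"

definition Ker2 :: "('g \<Rightarrow> 'd \<Rightarrow> complex) \<Rightarrow> 'd set" where
  "Ker2 \<phi> = {d. \<forall>a. \<phi> a d = 0}"

definition complementary_subspaces ::
  "(complex \<Rightarrow> 'd::ab_group_add \<Rightarrow> 'd) \<Rightarrow> 'd set \<Rightarrow> 'd set \<Rightarrow> bool" where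
  "complementary_subspaces scale U V \<longleftrightarrow>
     module.subspace scale U \<and> module.subspace scale V \<and>
     U \<inter> V = {0} \<and> (\<forall>d. \<exists>u\<in>U. \<exists>v\<in>V. d = u + v)"

definition infinite_dimensional ::
  "(complex \<Rightarrow> 'd::ab_group_add \<Rightarrow> 'd) \<Rightarrow> 'd set \<Rightarrow> bool" where
  "infinite_dimensional scale U \<longleftrightarrow>
     \<not> (\<exists>B. finite B \<and> module.span scale B = U)"


section \<open>The generalized Witt algebra and the modules of tensor densities\<close>

abbreviation complex_field :: "complex ring" where
  "complex_field \<equiv> ring_of_type_algebra"

text \<open>
  Since the \<open>t\<^sup>a\<close> form a basis of \<open>A = \<complex>[G]\<close>, the tensor product \<open>A \<otimes> X\<close> is the direct sum of
  the \<open>t\<^sup>a \<otimes> X\<close>. It is modelled by the finitely supported functions from \<open>G\<close> to \<open>X\<close>,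
  where \<open>t\<^sup>a \<otimes> x\<close> is \<open>Poly_Mapping.single a x\<close>. The next function is the biadditive extension of
  \<open>(t\<^sup>a \<otimes> x, t\<^sup>b \<otimes> y) \<mapsto> t\<^sup>a\<^sup>+\<^sup>b \<otimes> \<beta> a b x y\<close>.
\<close>

definition graded_extend ::
  "('g::plus \<Rightarrow> 'g \<Rightarrow> 'x::zero \<Rightarrow> 'y::zero \<Rightarrow> 'z::comm_monoid_add) \<Rightarrow>
   ('g \<Rightarrow>\<^sub>0 'x) \<Rightarrow> ('g \<Rightarrow>\<^sub>0 'y) \<Rightarrow> ('g \<Rightarrow>\<^sub>0 'z)" where
  "graded_extend \<beta> x y =
     (\<Sum>a\<in>Poly_Mapping.keys x. \<Sum>b\<in>Poly_Mapping.keys y.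
        Poly_Mapping.single (a + b)
          (\<beta> a b (Poly_Mapping.lookup x a) (Poly_Mapping.lookup y b)))"

definition witt_algebra ::
  "(complex \<Rightarrow> 'd::ab_group_add \<Rightarrow> 'd) \<Rightarrow> ('g::ab_group_add \<Rightarrow> 'd \<Rightarrow> complex) \<Rightarrow>
   (complex, 'g \<Rightarrow>\<^sub>0 'd) module" where
  "witt_algebra scale \<phi> =
     \<lparr>carrier = UNIV,
      monoid.mult = graded_extend (\<lambda>a a' d d'. scale (\<phi> a' d) d' - scale (\<phi> a d') d),
      one = undefined, zero = 0, add = (+),
      module.smult = (\<lambda>k. Poly_Mapping.map (scale k))\<rparr>"

abbreviation witt_isomorphic ::
  "(complex \<Rightarrow> 'd::ab_group_add \<Rightarrow> 'd) \<Rightarrow> ('g::ab_group_add \<Rightarrow> 'd \<Rightarrow> complex) \<Rightarrow>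
   (complex, 'm, 'g \<Rightarrow>\<^sub>0 'd) lie_mod \<Rightarrow> (complex, 'n, 'g \<Rightarrow>\<^sub>0 'd) lie_mod \<Rightarrow> bool" where
  "witt_isomorphic scale \<phi> \<equiv> lie_module_isomorphic complex_field (witt_algebra scale \<phi>)"

text \<open>\<open>gamma \<phi> c \<sigma>\<close> is \<open>\<Gamma>(V\<^sup>c, \<sigma>)\<close>, with \<open>V\<^sup>c = \<complex>v\<close> identified with \<open>\<complex>\<close> via \<open>v \<mapsto> 1\<close>.\<close>

definition gamma ::
  "('g::ab_group_add \<Rightarrow> 'd::ab_group_add \<Rightarrow> complex) \<Rightarrow> complex \<Rightarrow> ('d \<Rightarrow> complex) \<Rightarrow>
   (complex, 'g \<Rightarrow>\<^sub>0 complex, 'g \<Rightarrow>\<^sub>0 'd) lie_mod" where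
  "gamma \<phi> c \<sigma> =
     \<lparr>carrier = UNIV, monoid.mult = undefined, one = undefined, zero = 0, add = (+),
      module.smult = (\<lambda>k. Poly_Mapping.map ((*) k)),
      act = graded_extend (\<lambda>a b d z. (\<phi> b d + \<sigma> d + c * \<phi> a d) * z)\<rparr>"

text \<open>
  \<open>gamma_one \<phi> s\<close> and \<open>gamma_infty \<phi> s\<close> are \<open>\<Gamma>(\<sigma>, 1)\<close> and \<open>\<Gamma>(\<sigma>, \<infinity>)\<close> for the functional
  \<open>\<sigma> = \<phi> s\<close> that is identified with \<open>s \<in> G\<close>.
\<close>

definition gamma_one ::
  "('g::ab_group_add \<Rightarrow> 'd::ab_group_add \<Rightarrow> complex) \<Rightarrow> 'g \<Rightarrow>
   (complex, ('g \<Rightarrow>\<^sub>0 complex) set, 'g \<Rightarrow>\<^sub>0 'd) lie_mod" where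
  "gamma_one \<phi> s =
     quotient_lie_mod (gamma \<phi> 0 (\<phi> s)) {Poly_Mapping.single (- s) z | z. True}"

definition gamma_infty ::
  "('g::ab_group_add \<Rightarrow> 'd::ab_group_add \<Rightarrow> complex) \<Rightarrow> 'g \<Rightarrow>
   (complex, 'g \<Rightarrow>\<^sub>0 complex, 'g \<Rightarrow>\<^sub>0 'd) lie_mod" where
  "gamma_infty \<phi> s =
     (gamma \<phi> 1 (\<phi> s))\<lparr>carrier := {f. Poly_Mapping.keys f \<subseteq> {a. a \<noteq> - s}}\<rparr>"


section \<open>The constructions above yield a Lie algebra and Lie modules\<close>

lemma graded_extend_superset:
  assumes "finite S" "Poly_Mapping.keys x \<subseteq> S" "finite T" "Poly_Mapping.keys y \<subseteq> T"
    and "\<And>a b e. \<beta> a b 0 e = 0" "\<And>a b d. \<beta> a b d 0 = 0"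
  shows "graded_extend \<beta> x y = (\<Sum>a\<in>S. \<Sum>b\<in>T. Poly_Mapping.single (a + b)
          (\<beta> a b (Poly_Mapping.lookup x a) (Poly_Mapping.lookup y b)))"
proof -
  have "(\<Sum>b\<in>Poly_Mapping.keys y. Poly_Mapping.single (a + b)
          (\<beta> a b (Poly_Mapping.lookup x a) (Poly_Mapping.lookup y b))) =
        (\<Sum>b\<in>T. Poly_Mapping.single (a + b)
          (\<beta> a b (Poly_Mapping.lookup x a) (Poly_Mapping.lookup y b)))" for a
    by (rule sum.mono_neutral_left) (use assms in \<open>auto simp: in_keys_iff\<close>)
  then show ?thesis
    unfolding graded_extend_def
    by (simp, intro sum.mono_neutral_left) (use assms in \<open>auto simp: in_keys_iff\<close>)
qed

lemma graded_extend_single: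
  assumes "\<And>a b e. \<beta> a b 0 e = 0" "\<And>a b d. \<beta> a b d 0 = 0"
  shows "graded_extend \<beta> (Poly_Mapping.single a d) (Poly_Mapping.single b e) =
    Poly_Mapping.single (a + b) (\<beta> a b d e)"
  using assms by (subst graded_extend_superset[where S="{a}" and T="{b}"]) auto

lemma graded_extend_add_left:
  assumes "\<And>a b e. \<beta> a b 0 e = 0" "\<And>a b d. \<beta> a b d 0 = 0"
    and "\<And>a b d d' e. \<beta> a b (d + d') e = \<beta> a b d e + \<beta> a b d' e"
  shows "graded_extend \<beta> (x + x') y = graded_extend \<beta> x y + graded_extend \<beta> x' y"
proof -
  define S where "S = Poly_Mapping.keys x \<union> Poly_Mapping.keys x' \<union> Poly_Mapping.keys (x + x')"
  have S: "finite S" "Poly_Mapping.keys x \<subseteq> S" "Poly_Mapping.keys x' \<subseteq> S" "Poly_Mapping.keys (x + x') \<subseteq> S"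
    by (auto simp: S_def)
  note * = graded_extend_superset[of S _ "Poly_Mapping.keys y" y \<beta>]
  show ?thesis
    using S assms by (simp add: * lookup_add single_add sum.distrib)
qed

lemma graded_extend_add_right:
  assumes "\<And>a b e. \<beta> a b 0 e = 0" "\<And>a b d. \<beta> a b d 0 = 0"
    and "\<And>a b d e e'. \<beta> a b d (e + e') = \<beta> a b d e + \<beta> a b d e'"
  shows "graded_extend \<beta> x (y + y') = graded_extend \<beta> x y + graded_extend \<beta> x y'"
proof -
  define S where "S = Poly_Mapping.keys y \<union> Poly_Mapping.keys y' \<union> Poly_Mapping.keys (y + y')"
  have S: "finite S" "Poly_Mapping.keys y \<subseteq> S" "Poly_Mapping.keys y' \<subseteq> S" "Poly_Mapping.keys (y + y') \<subseteq> S"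
    by (auto simp: S_def)
  note * = graded_extend_superset[of "Poly_Mapping.keys x" x S _ \<beta>]
  show ?thesis
    using S assms by (simp add: * lookup_add single_add sum.distrib)
qed

lemma poly_mapping_single_induct [case_names single add]:
  fixes x :: "'g \<Rightarrow>\<^sub>0 'x::ab_group_add"
  assumes s: "\<And>a d. P (Poly_Mapping.single a d)" and add: "\<And>x y. P x \<Longrightarrow> P y \<Longrightarrow> P (x + y)"
  shows "P x"
proof (induction x rule: update_induct)
  case const
  show ?case using s[of undefined 0] by simp
next
  case (update f a b)
  have "Poly_Mapping.update a b f = f + Poly_Mapping.single a b"
    using update(1) by (intro poly_mapping_eqI)
      (auto simp: lookup_update lookup_add lookup_single in_keys_iff when_def)
  then show ?case using add[OF update(3) s] by simp
qed

lemma lookup_map_zero: "f 0 = 0 \<Longrightarrow> Poly_Mapping.lookup (Poly_Mapping.map f x) a = f (Poly_Mapping.lookup x a)"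
  by (simp add: Poly_Mapping.map.rep_eq when_def)

lemma map_add_hom: 
  assumes "f 0 = 0" "\<And>d e. f (d + e) = f d + f e"
  shows "Poly_Mapping.map f (x + y) = Poly_Mapping.map f x + Poly_Mapping.map f y"
  using assms by (intro poly_mapping_eqI) (simp add: lookup_map_zero lookup_add)

context witt_datum
begin

lemma phi_zero [simp]: "\<phi> 0 d = 0"
  using phi_add[of 0 0 d] by simp

lemma phi_uminus: "\<phi> (- a) d = - \<phi> a d"
  using phi_add[of a "- a" d] by (simp add: add_eq_0_iff2 add_eq_0_iff)

lemma phi_linear_simps [simp]: "\<phi> a 0 = 0" "\<phi> a (d + e) = \<phi> a d + \<phi> a e"
  "\<phi> a (d - e) = \<phi> a d - \<phi> a e"  "\<phi> a (scale k d) = k * \<phi> a d"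
proof -
  interpret l: Vector_Spaces.linear scale "(*)" "\<phi> a" by (rule phi_linear)
  show "\<phi> a 0 = 0" "\<phi> a (d + e) = \<phi> a d + \<phi> a e"
  "\<phi> a (d - e) = \<phi> a d - \<phi> a e"  "\<phi> a (scale k d) = k * \<phi> a d"
  by (simp_all add: l.zero l.add l.diff l.scale)
qed

definition witt_bracket :: "('g \<Rightarrow>\<^sub>0 'd) \<Rightarrow> ('g \<Rightarrow>\<^sub>0 'd) \<Rightarrow> ('g \<Rightarrow>\<^sub>0 'd)" where
  "witt_bracket = graded_extend (\<lambda>a a' d d'. scale (\<phi> a' d) d' - scale (\<phi> a d') d)"

lemma witt_bracket: 
  "witt_bracket (Poly_Mapping.single a d) (Poly_Mapping.single a' d') =
     Poly_Mapping.single (a + a') (scale (\<phi> a' d) d' - scale (\<phi> a d') d)"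
  "witt_bracket (x + x') y = witt_bracket x y + witt_bracket x' y"
  "witt_bracket x (y + y') = witt_bracket x y + witt_bracket x y'"
  unfolding witt_bracket_def
  by (subst graded_extend_single graded_extend_add_left graded_extend_add_right; 
      simp add: algebra_simps)+

lemma witt_bracket_anti: "witt_bracket x y = - witt_bracket y x"
proof (induction x rule: poly_mapping_single_induct)
  case (single a d)
  show ?case
    by (induction y rule: poly_mapping_single_induct)
       (simp_all add: witt_bracket single_uminus[symmetric] add.commute)
qed (simp add: witt_bracket)

lemma witt_bracket_self: "witt_bracket x x = 0"
  by (induction x rule: poly_mapping_single_induct) 
    (simp_all add: witt_bracket, metis witt_bracket_anti add.commute add.right_inverse)

lemma witt_bracket_map: "witt_bracket (Poly_Mapping.map (scale k) x) y = Poly_Mapping.map (scale k) (witt_bracket x y)"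
proof (induction x rule: poly_mapping_single_induct)
  case (single a d)
  show ?case
    by (induction y rule: poly_mapping_single_induct)
       (simp_all add: witt_bracket map_add_hom algebra_simps)
qed (simp add: witt_bracket map_add_hom algebra_simps)

lemma witt_bracket_map2: "witt_bracket x (Poly_Mapping.map (scale k) y) = Poly_Mapping.map (scale k) (witt_bracket x y)"
  by (rule poly_mapping_eqI, subst (1 2) witt_bracket_anti, simp add: witt_bracket_map lookup_map_zero)

lemma witt_bracket_jacobi:
  "witt_bracket x (witt_bracket y z) + witt_bracket y (witt_bracket z x) +
     witt_bracket z (witt_bracket x y) = 0"
proof -
  define J where "J = (\<lambda>x y z. witt_bracket x (witt_bracket y z) + witt_bracket y (witt_bracket z x) + witt_bracket z (witt_bracket x y))"
  have add: "J (x + x') y z = J x y z + J x' y z" "J x (y + y') z = J x y z + J x y' z"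
    "J x y (z + z') = J x y z + J x y z'" for x x' y y' z z'
    unfolding J_def witt_bracket by (simp_all only: ac_simps)
  have basis: "J (Poly_Mapping.single a d) (Poly_Mapping.single b e) (Poly_Mapping.single c f) = 0"
    for a b c d e f
    by (simp add: J_def witt_bracket single_add[symmetric] phi_add algebra_simps)
  have "J x y z = 0"
  proof (induction x rule: poly_mapping_single_induct)
    case (single a d)
    show ?case
    proof (induction y rule: poly_mapping_single_induct)
      case (single b e)
      show ?case
        by (induction z rule: poly_mapping_single_induct) (simp_all add: add basis)
    qed (simp add: add)
  qed (simp add: add)
  then show ?thesis
    by (simp add: J_def)
qed

lemma witt_module: "Module.module complex_field (witt_algebra scale \<phi>)"
proof (rule moduleI)
  show "cring complex_field" by (rule cring_from_type_algebra)
  show "abelian_group (witt_algebra scale \<phi>)"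
    by (rule abelian_groupI)
      (auto simp: witt_algebra_def ac_simps intro: exI[of _ "- x" for x])
qed (auto simp: witt_algebra_def ring_of_type_algebra_def poly_mapping_eq_iff fun_eq_iff
       lookup_map_zero lookup_add algebra_simps)

theorem witt_lie_algebra: "lie_algebra complex_field (witt_algebra scale \<phi>)"
proof (intro lie_algebra.intro lie_algebra_axioms.intro)
  show "Module.module complex_field (witt_algebra scale \<phi>)"
    by (rule witt_module)
qed (simp_all add: witt_algebra_def witt_bracket_def[symmetric] witt_bracket witt_bracket_map witt_bracket_map2 witt_bracket_self witt_bracket_jacobi)

end

lemma gamma_module: "Module.module complex_field (gamma \<phi> c \<sigma>)"
proof (rule moduleI)
  show "cring complex_field" by (rule cring_from_type_algebra)
  show "abelian_group (gamma \<phi> c \<sigma>)"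
    by (rule abelian_groupI)
      (auto simp: gamma_def ac_simps intro: exI[of _ "- x" for x])
qed (auto simp: gamma_def ring_of_type_algebra_def poly_mapping_eq_iff fun_eq_iff
       lookup_map_zero lookup_add algebra_simps)

lemma gamma_simps:
  "carrier (gamma \<phi> c \<sigma>) = UNIV" "zero (gamma \<phi> c \<sigma>) = 0" "add (gamma \<phi> c \<sigma>) = (+)"
  "module.smult (gamma \<phi> c \<sigma>) = (\<lambda>k. Poly_Mapping.map ((*) k))"
  by (simp_all add: gamma_def)

lemma gamma_minus: "f \<ominus>\<^bsub>gamma \<phi> c \<sigma>\<^esub> g = f - g"
proof -
  interpret Module.module complex_field "gamma \<phi> c \<sigma>" by (rule gamma_module)
  have "\<ominus>\<^bsub>gamma \<phi> c \<sigma>\<^esub> g = - g"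
    by (rule M.minus_equality) (simp_all add: gamma_simps)
  then show ?thesis
    by (simp add: a_minus_def gamma_simps)
qed

context witt_datum
begin

context
  fixes \<sigma> :: "'d \<Rightarrow> complex"
  assumes \<sigma>: "Vector_Spaces.linear scale (*) \<sigma>"
begin

lemma sigma_simps: "\<sigma> 0 = 0" "\<sigma> (d + e) = \<sigma> d + \<sigma> e"
  "\<sigma> (d - e) = \<sigma> d - \<sigma> e"  "\<sigma> (scale k d) = k * \<sigma> d"
proof -
  interpret l: Vector_Spaces.linear scale "(*)" \<sigma> by (rule \<sigma>)
  show "\<sigma> 0 = 0" "\<sigma> (d + e) = \<sigma> d + \<sigma> e"
    "\<sigma> (d - e) = \<sigma> d - \<sigma> e"  "\<sigma> (scale k d) = k * \<sigma> d"
    by (simp_all add: l.zero l.add l.diff l.scale)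
qed

lemma gamma_act:
  "act (gamma \<phi> c \<sigma>) (Poly_Mapping.single a d) (Poly_Mapping.single b z) =
     Poly_Mapping.single (a + b) ((\<phi> b d + \<sigma> d + c * \<phi> a d) * z)"
  "act (gamma \<phi> c \<sigma>) (x + x') f = act (gamma \<phi> c \<sigma>) x f + act (gamma \<phi> c \<sigma>) x' f"
  "act (gamma \<phi> c \<sigma>) x (f + f') = act (gamma \<phi> c \<sigma>) x f + act (gamma \<phi> c \<sigma>) x f'"
  unfolding gamma_def lie_mod.simps
  by (subst graded_extend_single graded_extend_add_left graded_extend_add_right; 
      simp add: sigma_simps algebra_simps)+

lemma gamma_act_map_left: "act (gamma \<phi> c \<sigma>) (Poly_Mapping.map (scale k) x) f
    = Poly_Mapping.map ((*) k) (act (gamma \<phi> c \<sigma>) x f)"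
proof (induction x rule: poly_mapping_single_induct)
  case (single a d)
  show ?case
    by (induction f rule: poly_mapping_single_induct)
       (simp_all add: gamma_act map_add_hom sigma_simps algebra_simps)
qed (simp add: gamma_act map_add_hom algebra_simps)

lemma gamma_act_map_right: "act (gamma \<phi> c \<sigma>) x (Poly_Mapping.map ((*) k) f)
    = Poly_Mapping.map ((*) k) (act (gamma \<phi> c \<sigma>) x f)"
proof (induction x rule: poly_mapping_single_induct)
  case (single a d)
  show ?case
    by (induction f rule: poly_mapping_single_induct)
       (simp_all add: gamma_act map_add_hom sigma_simps algebra_simps)
qed (simp add: gamma_act map_add_hom algebra_simps)

lemma gamma_act_bracket: "act (gamma \<phi> c \<sigma>) (witt_bracket x y) f =
    act (gamma \<phi> c \<sigma>) x (act (gamma \<phi> c \<sigma>) y f) - act (gamma \<phi> c \<sigma>) y (act (gamma \<phi> c \<sigma>) x f)"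
proof (induction x rule: poly_mapping_single_induct)
  case (single a d)
  show ?case
  proof (induction y rule: poly_mapping_single_induct)
    case (single b e)
    show ?case
      by (induction f rule: poly_mapping_single_induct)
        (simp_all add: gamma_act witt_bracket single_diff[symmetric] sigma_simps phi_add algebra_simps)
  qed (simp add: gamma_act witt_bracket)
qed (simp add: gamma_act witt_bracket)

theorem gamma_lie_module: "lie_module complex_field (witt_algebra scale \<phi>) (gamma \<phi> c \<sigma>)"
proof (intro lie_module.intro lie_module_axioms.intro witt_lie_algebra gamma_module)
qed (simp_all add: gamma_simps gamma_minus witt_algebra_def gamma_act witt_bracket_def[symmetric]
       gamma_act_bracket gamma_act_map_left gamma_act_map_right)

end

end

lemma (in lie_submodule) restrict_lie_module: "lie_module R L (M\<lparr>carrier := N\<rparr>)"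
proof -
  have sub: "n \<in> carrier M" if "n \<in> N" for n
    using that a_subset by blast
  have ag: "abelian_group (M\<lparr>carrier := N\<rparr>)"
  proof (rule abelian_groupI)
    fix x assume "x \<in> carrier (M\<lparr>carrier := N\<rparr>)"
    then show "\<exists>y\<in>carrier (M\<lparr>carrier := N\<rparr>). y \<oplus>\<^bsub>M\<lparr>carrier := N\<rparr>\<^esub> x = \<zero>\<^bsub>M\<lparr>carrier := N\<rparr>\<^esub>"
      using sub by (intro bexI[of _ "\<ominus>\<^bsub>M\<^esub> x"]) (auto simp: M.l_neg a_inv_closed)
  qed (auto simp: sub a_closed zero_closed M.a_ac)
  interpret N: abelian_group "M\<lparr>carrier := N\<rparr>" by (rule ag)
  have minus: "x \<ominus>\<^bsub>M\<lparr>carrier := N\<rparr>\<^esub> y = x \<ominus>\<^bsub>M\<^esub> y" if "x \<in> N" "y \<in> N" for x y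
  proof -
    have "\<ominus>\<^bsub>M\<lparr>carrier := N\<rparr>\<^esub> y = \<ominus>\<^bsub>M\<^esub> y"
      using that sub a_inv_closed by (intro N.minus_equality) (auto simp: M.l_neg)
    then show ?thesis
      by (simp add: a_minus_def)
  qed
  show ?thesis
    by (intro lie_module.intro L.lie_algebra_axioms moduleI ag lie_module_axioms.intro)
      (auto simp: sub minus submodule_smult_closed submodule_act_closed L.R.cring_axioms smult_l_distr
         smult_r_distr smult_assoc1 act_add_left act_add_right act_smult_left act_smult_right
         act_bracket)
qed

sublocale lie_submodule \<subseteq> abelian_subgroup N M
  by (rule abelian_subgroupI3) unfold_locales

context lie_submodule
begin

lemma quotient_fun:
  assumes "m \<in> carrier M" "\<And>n. n \<in> carrier M \<Longrightarrow> g n \<in> carrier M"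
    "\<And>n. n \<in> N \<Longrightarrow> g n \<in> N"
    "\<And>n n'. n \<in> carrier M \<Longrightarrow> n' \<in> carrier M \<Longrightarrow> g (n \<oplus>\<^bsub>M\<^esub> n') = g n \<oplus>\<^bsub>M\<^esub> g n'"
  shows "(\<Union>n\<in>N +>\<^bsub>M\<^esub> m. N +>\<^bsub>M\<^esub> g n) = N +>\<^bsub>M\<^esub> g m"
proof -
  have "N +>\<^bsub>M\<^esub> g n = N +>\<^bsub>M\<^esub> g m" if n: "n \<in> N +>\<^bsub>M\<^esub> m" for n
  proof -
    obtain h where h: "h \<in> N" "n = h \<oplus>\<^bsub>M\<^esub> m"
      using n by (auto simp: a_r_coset_def')
    then have "g n = g h \<oplus>\<^bsub>M\<^esub> g m" "g h \<in> N"
      using assms a_Hcarr by auto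
    then have "g n \<in> N +>\<^bsub>M\<^esub> g m"
      by (auto simp: a_r_coset_def')
    then show ?thesis
      using assms(1,2) a_repr_independence' by metis
  qed
  moreover have "m \<in> N +>\<^bsub>M\<^esub> m"
    using assms(1) by (rule a_rcos_self)
  ultimately show ?thesis
    by blast
qed

lemma quotient_smult:
  "k \<in> carrier R \<Longrightarrow> m \<in> carrier M \<Longrightarrow>
    k \<odot>\<^bsub>quotient_lie_mod M N\<^esub> (N +>\<^bsub>M\<^esub> m) = N +>\<^bsub>M\<^esub> (k \<odot>\<^bsub>M\<^esub> m)"
  unfolding quotient_lie_mod_def
  by (simp, rule quotient_fun) (auto simp: smult_r_distr submodule_smult_closed)

lemma quotient_act:
  "x \<in> carrier L \<Longrightarrow> m \<in> carrier M \<Longrightarrow>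
    act (quotient_lie_mod M N) x (N +>\<^bsub>M\<^esub> m) = N +>\<^bsub>M\<^esub> act M x m"
  unfolding quotient_lie_mod_def
  by (simp, rule quotient_fun) (auto simp: act_add_right act_closed submodule_act_closed)

lemma quotient_simps:
  "carrier (quotient_lie_mod M N) = (\<lambda>m. N +>\<^bsub>M\<^esub> m) ` carrier M"
  "add (quotient_lie_mod M N) = set_add M"
  "zero (quotient_lie_mod M N) = N"
  by (auto simp: quotient_lie_mod_def A_RCOSETS_def')

lemma quotient_abelian_group: "abelian_group (quotient_lie_mod M N)"
proof (rule abelian_groupI)
  fix C assume "C \<in> carrier (quotient_lie_mod M N)"
  then obtain m where "m \<in> carrier M" "C = N +>\<^bsub>M\<^esub> m"
    by (auto simp: quotient_simps)
  then show "\<exists>C'\<in>carrier (quotient_lie_mod M N).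
      C' \<oplus>\<^bsub>quotient_lie_mod M N\<^esub> C = \<zero>\<^bsub>quotient_lie_mod M N\<^esub>"
    by (intro bexI[of _ "N +>\<^bsub>M\<^esub> (\<ominus>\<^bsub>M\<^esub> m)"])
      (auto simp: quotient_simps a_rcos_sum M.l_neg a_subset)
next
  show "\<zero>\<^bsub>quotient_lie_mod M N\<^esub> \<in> carrier (quotient_lie_mod M N)"
    unfolding quotient_simps using a_subset by (intro image_eqI[of _ _ "\<zero>\<^bsub>M\<^esub>"]) auto
next
  fix C assume "C \<in> carrier (quotient_lie_mod M N)"
  then obtain m where m: "m \<in> carrier M" "C = N +>\<^bsub>M\<^esub> m"
    by (auto simp: quotient_simps)
  have "(N +>\<^bsub>M\<^esub> \<zero>\<^bsub>M\<^esub>) <+>\<^bsub>M\<^esub> (N +>\<^bsub>M\<^esub> m) = N +>\<^bsub>M\<^esub> m"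
    using m by (simp add: a_rcos_sum del: a_coset_add_zero)
  then show "\<zero>\<^bsub>quotient_lie_mod M N\<^esub> \<oplus>\<^bsub>quotient_lie_mod M N\<^esub> C = C"
    using m a_subset by (simp add: quotient_simps)
qed (auto simp: quotient_simps a_rcos_sum M.a_ac)

lemma quotient_minus:
  assumes "m \<in> carrier M" "n \<in> carrier M"
  shows "(N +>\<^bsub>M\<^esub> m) \<ominus>\<^bsub>quotient_lie_mod M N\<^esub> (N +>\<^bsub>M\<^esub> n) = N +>\<^bsub>M\<^esub> (m \<ominus>\<^bsub>M\<^esub> n)"
proof -
  interpret Q: abelian_group "quotient_lie_mod M N" by (rule quotient_abelian_group)
  have "\<ominus>\<^bsub>quotient_lie_mod M N\<^esub> (N +>\<^bsub>M\<^esub> n) = N +>\<^bsub>M\<^esub> (\<ominus>\<^bsub>M\<^esub> n)"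
    using assms by (intro Q.minus_equality) (auto simp: quotient_simps a_rcos_sum M.l_neg a_subset)
  then show ?thesis
    using assms by (simp add: a_minus_def quotient_simps a_rcos_sum)
qed

theorem quotient_lie_module: "lie_module R L (quotient_lie_mod M N)"
proof (intro lie_module.intro L.lie_algebra_axioms moduleI quotient_abelian_group
    lie_module_axioms.intro L.R.cring_axioms)
  fix x y C assume xy: "x \<in> carrier L" "y \<in> carrier L" and "C \<in> carrier (quotient_lie_mod M N)"
  then obtain m where m: "m \<in> carrier M" "C = N +>\<^bsub>M\<^esub> m"
    by (auto simp: quotient_simps)
  show "act (quotient_lie_mod M N) (x \<otimes>\<^bsub>L\<^esub> y) C =
      act (quotient_lie_mod M N) x (act (quotient_lie_mod M N) y C)
      \<ominus>\<^bsub>quotient_lie_mod M N\<^esub> act (quotient_lie_mod M N) y (act (quotient_lie_mod M N) x C)"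
    using m xy L.bracket_closed[OF xy]
    by (simp add: quotient_act quotient_minus act_closed act_bracket)
qed (auto simp: quotient_simps(1), auto simp: quotient_simps(2,3) quotient_smult quotient_act
       a_rcos_sum smult_l_distr smult_r_distr smult_assoc1 act_closed
       act_add_left act_add_right act_smult_left act_smult_right)

end

context witt_datum
begin

theorem gamma_one_lie_module: "lie_module complex_field (witt_algebra scale \<phi>) (gamma_one \<phi> s)"
proof -
  interpret lie_module complex_field "witt_algebra scale \<phi>" "gamma \<phi> 0 (\<phi> s)"
    by (rule gamma_lie_module[OF phi_linear])
  let ?N = "{Poly_Mapping.single (- s) z | z. True} :: ('g \<Rightarrow>\<^sub>0 complex) set"
  have act: "act (gamma \<phi> 0 (\<phi> s)) x (Poly_Mapping.single (- s) z) = 0" for x z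
    by (induction x rule: poly_mapping_single_induct)
      (simp_all add: gamma_act[OF phi_linear] phi_uminus)
  interpret lie_submodule complex_field "witt_algebra scale \<phi>" ?N "gamma \<phi> 0 (\<phi> s)"
  proof (intro lie_submodule.intro lie_submodule_axioms.intro lie_module_axioms)
    show "additive_subgroup ?N (gamma \<phi> 0 (\<phi> s))"
    proof (intro additive_subgroup.intro M.add.subgroupI)
      show "\<ominus>\<^bsub>gamma \<phi> 0 (\<phi> s)\<^esub> a \<in> ?N" if "a \<in> ?N" for a
      proof -
        have "\<ominus>\<^bsub>gamma \<phi> 0 (\<phi> s)\<^esub> a = - a"
          by (intro M.minus_equality) (simp_all add: gamma_simps)
        then show ?thesis
          using that by (auto simp: single_uminus[symmetric])
      qed
    qed (auto simp: gamma_simps single_add[symmetric])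
    show "act (gamma \<phi> 0 (\<phi> s)) x n \<in> ?N" if "n \<in> ?N" for x n
      using that act single_zero by (auto intro: exI[of _ 0])
  qed (auto simp: gamma_simps)
  show ?thesis
    unfolding gamma_one_def by (rule quotient_lie_module)
qed

theorem gamma_infty_lie_module:
  "lie_module complex_field (witt_algebra scale \<phi>) (gamma_infty \<phi> s)"
proof -
  interpret lie_module complex_field "witt_algebra scale \<phi>" "gamma \<phi> 1 (\<phi> s)"
    by (rule gamma_lie_module[OF phi_linear])
  let ?N = "{f. Poly_Mapping.keys f \<subseteq> {a. a \<noteq> - s}} :: ('g \<Rightarrow>\<^sub>0 complex) set"
  have N: "f \<in> ?N \<longleftrightarrow> Poly_Mapping.lookup f (- s) = 0" for f
    by (auto simp: in_keys_iff)
  have act: "Poly_Mapping.lookup (act (gamma \<phi> 1 (\<phi> s)) x f) (- s) = 0" for x f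
  proof (induction x rule: poly_mapping_single_induct)
    case (single a d)
    show ?case
    proof (induction f rule: poly_mapping_single_induct)
      case (single b z)
      have "\<phi> b d + \<phi> s d + \<phi> a d = \<phi> (a + b + s) d"
        by (simp add: phi_add)
      also have "\<dots> = 0" if "a + b = - s"
        using that by simp
      finally show ?case
        by (auto simp: gamma_act[OF phi_linear] lookup_single when_def)
    qed (simp add: gamma_act[OF phi_linear] lookup_add)
  qed (simp add: gamma_act[OF phi_linear] lookup_add)
  interpret lie_submodule complex_field "witt_algebra scale \<phi>" ?N "gamma \<phi> 1 (\<phi> s)"
  proof (intro lie_submodule.intro lie_submodule_axioms.intro lie_module_axioms)
    show "additive_subgroup ?N (gamma \<phi> 1 (\<phi> s))"
    proof (intro additive_subgroup.intro M.add.subgroupI)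
      show "\<ominus>\<^bsub>gamma \<phi> 1 (\<phi> s)\<^esub> a \<in> ?N" if "a \<in> ?N" for a
      proof -
        have "\<ominus>\<^bsub>gamma \<phi> 1 (\<phi> s)\<^esub> a = - a"
          by (intro M.minus_equality) (simp_all add: gamma_simps)
        then show ?thesis
          using that unfolding N by simp
      qed
    next
      show "?N \<noteq> {}"
        by (auto intro: exI[of _ 0])
    qed (simp_all only: N, simp_all add: gamma_simps lookup_add)
  qed (simp_all only: N act, simp_all add: gamma_simps lookup_map_zero)
  show ?thesis
    unfolding gamma_infty_def by (rule restrict_lie_module)
qed

end

end

theory Submission
  imports Defs
begin

text \<open>
  The elements \<open>t\<^sup>0 d\<close> act diagonally, and since \<open>Ker1 \<phi> = 0\<close> their weight spaces are the lines
  \<open>\<complex>t\<^sup>b\<close>, so homomorphisms preserve these lines. The module \<open>\<Gamma>(V\<^sup>c, \<sigma>)\<close> with \<open>\<sigma> = \<phi> s\<close> has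
  the weight \<open>0\<close>, at \<open>t\<^sup>-\<^sup>s\<close>, and the modules \<open>\<Gamma>(\<sigma>, 1)\<close> and \<open>\<Gamma>(\<sigma>, \<infinity>)\<close> do not. In the other cases the action
  of \<open>t\<^sup>a d\<close> on \<open>t\<^sup>b\<close> is compared for some \<open>a\<close>, \<open>b\<close> with \<open>a\<close> and \<open>b + \<sigma>\<close> linearly
  independent; these exist because \<open>G\<close> spans more than a line in the dual of \<open>D\<close>.
\<close>

section \<open>Homomorphisms and isomorphisms of Lie modules\<close>

lemma lie_module_hom_zero:
  assumes "lie_module R L M" "lie_module R L N" "f \<in> lie_module_hom R L M N"
  shows "f \<zero>\<^bsub>M\<^esub> = \<zero>\<^bsub>N\<^esub>"
proof -
  interpret M: lie_module R L M by fact
  interpret N: lie_module R L N by fact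
  have closed: "f \<zero>\<^bsub>M\<^esub> \<in> carrier N"
    using assms(3) M.M.zero_closed by (auto simp: lie_module_hom_def)
  have "f (\<zero>\<^bsub>M\<^esub> \<oplus>\<^bsub>M\<^esub> \<zero>\<^bsub>M\<^esub>) = f \<zero>\<^bsub>M\<^esub> \<oplus>\<^bsub>N\<^esub> f \<zero>\<^bsub>M\<^esub>"
    using assms(3) M.M.zero_closed unfolding lie_module_hom_def by blast
  then have "f \<zero>\<^bsub>M\<^esub> \<oplus>\<^bsub>N\<^esub> f \<zero>\<^bsub>M\<^esub> = f \<zero>\<^bsub>M\<^esub>"
    by simp
  then show ?thesis
    using N.M.add.l_cancel_one[OF closed closed] by simp
qed

text \<open>Having a nonzero vector killed by \<open>S\<close> is an isomorphism invariant. It is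
  applied below with \<open>S\<close> the set of all \<open>t^0 d\<close>, where it detects the
  weight 0.\<close>

lemma lie_module_isomorphic_annihilated:
  assumes M: "lie_module R L M" and N: "lie_module R L N"
    and iso: "lie_module_isomorphic R L M N" and S: "S \<subseteq> carrier L"
    and m: "m \<in> carrier M" "m \<noteq> \<zero>\<^bsub>M\<^esub>" "\<And>x. x \<in> S \<Longrightarrow> act M x m = \<zero>\<^bsub>M\<^esub>"
  shows "\<exists>n\<in>carrier N. n \<noteq> \<zero>\<^bsub>N\<^esub> \<and> (\<forall>x\<in>S. act N x n = \<zero>\<^bsub>N\<^esub>)"
proof -
  interpret M: lie_module R L M by (rule M)
  from iso obtain f where f: "f \<in> lie_module_hom R L M N" and bij: "bij_betw f (carrier M) (carrier N)"
    unfolding lie_module_isomorphic_def by blast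
  have zero: "f \<zero>\<^bsub>M\<^esub> = \<zero>\<^bsub>N\<^esub>"
    by (rule lie_module_hom_zero[OF M N f])
  have "act N x (f m) = \<zero>\<^bsub>N\<^esub>" if "x \<in> S" for x
  proof -
    have "f (act M x m) = act N x (f m)"
      using f S m(1) that unfolding lie_module_hom_def by blast
    then show ?thesis
      using zero m(3)[OF that] by simp
  qed
  moreover have "f m \<noteq> \<zero>\<^bsub>N\<^esub>"
    using inj_onD[OF bij_betw_imp_inj_on[OF bij], of m "\<zero>\<^bsub>M\<^esub>"] m(1,2) zero M.M.zero_closed by auto
  ultimately show ?thesis
    using bij_betwE[OF bij] m(1) by blast
qed

text \<open>Lets a homomorphism out of a quotient be studied through its composite with the
  projection.\<close>

lemma (in lie_submodule) quotient_map_hom: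
  "(\<lambda>m. N +>\<^bsub>M\<^esub> m) \<in> lie_module_hom R L M (quotient_lie_mod M N)"
  by (simp add: lie_module_hom_def quotient_simps a_rcos_sum quotient_smult quotient_act)

lemma lie_module_hom_compose:
  "f \<in> lie_module_hom R L M N \<Longrightarrow> g \<in> lie_module_hom R L N P \<Longrightarrow> g \<circ> f \<in> lie_module_hom R L M P"
  unfolding lie_module_hom_def by (auto simp: Pi_iff)

lemma single_eq_zero_iff: "Poly_Mapping.single a z = 0 \<longleftrightarrow> z = 0"
  by (metis lookup_single_eq lookup_zero single_zero)

section \<open>The pairing and the weight spaces of \<open>gamma\<close>\<close>

context witt_datum
begin

abbreviation witt_hom where
  "witt_hom \<equiv> lie_module_hom complex_field (witt_algebra scale \<phi>)"

lemma witt_carrier [simp]: "carrier (witt_algebra scale \<phi>) = UNIV"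
  by (simp add: witt_algebra_def)

lemma phi_separates:
  assumes "Ker1 \<phi> = {0}" "a \<noteq> b"
  shows "\<exists>d. \<phi> a d \<noteq> \<phi> b d"
proof (rule ccontr)
  assume "\<not> ?thesis"
  then have "\<phi> (a - b) d = 0" for d
    using phi_add[of "a - b" b d] by simp
  then have "a - b \<in> Ker1 \<phi>"
    by (simp add: Ker1_def)
  then show False
    using assms by simp
qed

text \<open>Here the infinite dimension enters: otherwise \<open>\<phi> a\<close> is injective on
  \<open>U\<close>, and \<open>U\<close> has dimension at most one.\<close>

lemma exists_independent:
  assumes compl: "complementary_subspaces scale U (Ker2 \<phi>)"
    and inf: "infinite_dimensional scale U"
  shows "\<exists>b d. \<phi> a d = 0 \<and> \<phi> b d \<noteq> 0"
proof (rule ccontr)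
  assume "\<not> ?thesis"
  then have ker: "d \<in> Ker2 \<phi>" if "\<phi> a d = 0" for d
    using that by (auto simp: Ker2_def)
  have U: "subspace U" and U0: "U \<inter> Ker2 \<phi> = {0}"
    using compl by (auto simp: complementary_subspaces_def)
  have zero: "u = 0" if "u \<in> U" "\<phi> a u = 0" for u
    using ker[OF that(2)] that(1) U0 by blast
  have "\<exists>B. finite B \<and> span B = U"
  proof (cases "\<exists>u\<in>U. u \<noteq> 0")
    case True
    then obtain u where u: "u \<in> U" "u \<noteq> 0"
      by blast
    then have au: "\<phi> a u \<noteq> 0"
      using zero by blast
    have "v \<in> span {u}" if v: "v \<in> U" for v
    proof -
      \<comment> \<open>The combination lies in \<open>U\<close> and is killed by
        \<open>\<phi> a\<close>, so \<open>zero\<close> applies and \<open>v\<close> is a multiple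
        of \<open>u\<close>.\<close>
      have "v - scale (\<phi> a v / \<phi> a u) u = 0"
        using au by (intro zero subspace_diff subspace_scale U u v) simp
      then show ?thesis
        by (simp add: span_singleton)
    qed
    moreover have "span {u} \<subseteq> U"
      using u U by (intro span_minimal) auto
    ultimately show ?thesis
      by (intro exI[of _ "{u}"]) auto
  next
    case False
    then have "U = {0}"
      using subspace_0[OF U] by blast
    then show ?thesis
      by (intro exI[of _ "{}"]) simp
  qed
  then show False
    using inf by (simp add: infinite_dimensional_def)
qed

lemma lookup_gamma_act_zero:
  assumes "Vector_Spaces.linear scale (*) \<sigma>"
  shows "Poly_Mapping.lookup (act (gamma \<phi> c \<sigma>) (Poly_Mapping.single 0 d) f) b =
    (\<phi> b d + \<sigma> d) * Poly_Mapping.lookup f b"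
proof (induction f rule: poly_mapping_single_induct)
  case (single a z)
  show ?case
    by (cases "a = b") (simp_all add: gamma_act(1)[OF assms] lookup_single)
next
  case (add f g)
  then show ?case
    by (simp only: gamma_act(3)[OF assms] lookup_add distrib_left)
qed

text \<open>Since \<open>Ker1 \<phi> = {0}\<close>, different basis vectors have different weights,
  so a weight vector has at most one nonzero coefficient.\<close>

lemma gamma_weight_space:
  assumes ker: "Ker1 \<phi> = {0}" and \<sigma>: "Vector_Spaces.linear scale (*) \<sigma>"
    and f: "\<And>d. act (gamma \<phi> c \<sigma>) (Poly_Mapping.single 0 d) f = Poly_Mapping.map ((*) (\<phi> b d + \<sigma> d)) f"
  shows "f = Poly_Mapping.single b (Poly_Mapping.lookup f b)"
proof (rule poly_mapping_eqI)
  fix a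
  have "Poly_Mapping.lookup f a = 0" if a: "a \<noteq> b"
  proof -
    obtain d where "\<phi> a d \<noteq> \<phi> b d"
      using phi_separates[OF ker a] by blast
    moreover have "(\<phi> a d + \<sigma> d) * Poly_Mapping.lookup f a = (\<phi> b d + \<sigma> d) * Poly_Mapping.lookup f a"
      using arg_cong[OF f[of d], of "\<lambda>g. Poly_Mapping.lookup g a"]
      by (simp add: lookup_gamma_act_zero[OF \<sigma>] lookup_map_zero)
    ultimately show ?thesis
      by simp
  qed
  then show "Poly_Mapping.lookup f a = Poly_Mapping.lookup (Poly_Mapping.single b (Poly_Mapping.lookup f b)) a"
    by (auto simp: lookup_single when_def)
qed

section \<open>Homomorphisms between tensor density modules\<close>

lemma gamma_homD:
  assumes "h \<in> witt_hom (gamma \<phi> c \<sigma>) (gamma \<phi> c' \<sigma>')"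
  shows "h (Poly_Mapping.map ((*) k) f) = Poly_Mapping.map ((*) k) (h f)"
    and "h (act (gamma \<phi> c \<sigma>) x f) = act (gamma \<phi> c' \<sigma>') x (h f)"
  using assms by (simp_all add: lie_module_hom_def gamma_simps ring_of_type_algebra_def)

text \<open>The map commutes with all \<open>t^0 d\<close>, whose action does not involve the
  parameters \<open>c\<close> and \<open>c'\<close>, so the image of \<open>t^b\<close> satisfies
  the weight equation of \<open>t^b\<close>.\<close>

lemma gamma_hom_single:
  assumes ker: "Ker1 \<phi> = {0}" and \<sigma>: "Vector_Spaces.linear scale (*) \<sigma>"
    and h: "h \<in> witt_hom (gamma \<phi> c \<sigma>) (gamma \<phi> c' \<sigma>)"
  obtains z where "h (Poly_Mapping.single b 1) = Poly_Mapping.single b z"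
proof (rule that, rule gamma_weight_space[OF ker \<sigma>])
  fix d
  have "act (gamma \<phi> c \<sigma>) (Poly_Mapping.single 0 d) (Poly_Mapping.single b 1) =
      Poly_Mapping.map ((*) (\<phi> b d + \<sigma> d)) (Poly_Mapping.single b 1)"
    by (simp add: gamma_act[OF \<sigma>])
  from arg_cong[OF this, of h]
  show "act (gamma \<phi> c' \<sigma>) (Poly_Mapping.single 0 d) (h (Poly_Mapping.single b 1)) =
      Poly_Mapping.map ((*) (\<phi> b d + \<sigma> d)) (h (Poly_Mapping.single b 1))"
    by (simp only: gamma_homD[OF h])
qed

lemma gamma_isomorphic_refl: "witt_isomorphic scale \<phi> (gamma \<phi> c \<sigma>) (gamma \<phi> c \<sigma>)"
  unfolding lie_module_isomorphic_def
  by (intro bexI[of _ id]) (auto simp: lie_module_hom_def)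

text \<open>The action of \<open>t^a u\<close> on \<open>t^b\<close> relates the coefficients
  \<open>z\<close> and \<open>y\<close> of the isomorphism at \<open>t^b\<close> and
  \<open>t^(a+b)\<close>. A \<open>u\<close> with \<open>\<phi> a u = 0\<close> gives
  \<open>y = z\<close>; one with \<open>\<phi> a u \<noteq> 0\<close> then gives
  \<open>c = c'\<close>.\<close>

lemma gamma_isomorphic_imp_eq:
  assumes compl: "complementary_subspaces scale U (Ker2 \<phi>)"
    and ker: "Ker1 \<phi> = {0}"
    and inf: "infinite_dimensional scale U"
    and \<sigma>: "Vector_Spaces.linear scale (*) \<sigma>"
    and iso: "witt_isomorphic scale \<phi> (gamma \<phi> c \<sigma>) (gamma \<phi> c' \<sigma>)"
  shows "c = c'"
proof -
  obtain h where h: "h \<in> witt_hom (gamma \<phi> c \<sigma>) (gamma \<phi> c' \<sigma>)" and bij: "bij h"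
    using iso by (auto simp: lie_module_isomorphic_def gamma_simps)
  obtain a :: 'g where a: "a \<noteq> 0"
    using group_nonzero by blast
  obtain e where e: "\<phi> a e \<noteq> 0"
    using phi_separates[OF ker a] by auto
  obtain b0 d where d: "\<phi> a d = 0" "\<phi> b0 d \<noteq> 0"
    using exists_independent[OF compl inf] by blast
  \<comment> \<open>Take \<open>b = 0\<close> if \<open>\<sigma> d \<noteq> 0\<close>, and
    \<open>b = b0\<close> otherwise.\<close>
  obtain b where b: "\<phi> b d + \<sigma> d \<noteq> 0"
    by (metis d(2) phi_zero add_0 add.right_neutral)
  obtain z where z: "h (Poly_Mapping.single b 1) = Poly_Mapping.single b z"
    by (rule gamma_hom_single[OF ker \<sigma> h])
  \<comment> \<open>Both sides are the image under \<open>h\<close> of \<open>t^a u\<close> acting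
    on \<open>t^b\<close>: the action is evaluated before \<open>h\<close> on the left, after
    \<open>h\<close> on the right.\<close>
  have eq: "Poly_Mapping.map ((*) (\<phi> b u + \<sigma> u + c * \<phi> a u)) (h (Poly_Mapping.single (a + b) 1)) =
      Poly_Mapping.single (a + b) ((\<phi> b u + \<sigma> u + c' * \<phi> a u) * z)" for u
  proof -
    have "h (Poly_Mapping.map ((*) (\<phi> b u + \<sigma> u + c * \<phi> a u)) (Poly_Mapping.single (a + b) 1)) =
        h (act (gamma \<phi> c \<sigma>) (Poly_Mapping.single a u) (Poly_Mapping.single b 1))"
      by (simp add: gamma_act[OF \<sigma>])
    then show ?thesis
      by (simp only: gamma_homD[OF h] z) (simp only: gamma_act[OF \<sigma>])
  qed
  define y where "y = Poly_Mapping.lookup (h (Poly_Mapping.single (a + b) 1)) (a + b)"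
  have y: "(\<phi> b u + \<sigma> u + c * \<phi> a u) * y = (\<phi> b u + \<sigma> u + c' * \<phi> a u) * z" for u
    using arg_cong[OF eq[of u], of "\<lambda>f. Poly_Mapping.lookup f (a + b)"]
    by (simp add: y_def lookup_map_zero)
  \<comment> \<open>As \<open>\<phi> a d = 0\<close>, both parameters drop out and the common
    nonzero factor cancels.\<close>
  have yz: "y = z"
    using y[of d] d(1) b by simp
  have "z \<noteq> 0"
  proof
    assume "z = 0"
    then have "h (Poly_Mapping.single b 1) = h 0"
      using z lie_module_hom_zero[OF gamma_lie_module[OF \<sigma>] gamma_lie_module[OF \<sigma>] h]
      by (simp add: gamma_simps)
    then have "Poly_Mapping.single b (1 :: complex) = 0"
      using bij by (simp add: bij_def inj_eq)
    then show False
      by (simp add: single_eq_zero_iff)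
  qed
  then show ?thesis
    using y[of e] yz e by simp
qed

section \<open>The quotient and the submodule attached to a weight in the group\<close>

lemma gamma_one_submodule:
  "lie_submodule complex_field (witt_algebra scale \<phi>) {Poly_Mapping.single (- s) z | z. True}
    (gamma \<phi> 0 (\<phi> s))"
proof -
  interpret lie_module complex_field "witt_algebra scale \<phi>" "gamma \<phi> 0 (\<phi> s)"
    by (rule gamma_lie_module[OF phi_linear])
  let ?N = "{Poly_Mapping.single (- s) z | z. True} :: ('g \<Rightarrow>\<^sub>0 complex) set"
  \<comment> \<open>The parameter is 0, so the coefficient is just the weight
    \<open>\<phi> (- s) d + \<phi> s d = 0\<close>, and the whole algebra kills this line.\<close>
  have kill: "act (gamma \<phi> 0 (\<phi> s)) x (Poly_Mapping.single (- s) z) = 0" for x z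
    by (induction x rule: poly_mapping_single_induct)
      (simp_all add: gamma_act[OF phi_linear] phi_uminus)
  have minus: "\<ominus>\<^bsub>gamma \<phi> 0 (\<phi> s)\<^esub> f = - f" for f
    by (rule M.minus_equality) (simp_all add: gamma_simps)
  have "additive_subgroup ?N (gamma \<phi> 0 (\<phi> s))"
    by (intro additive_subgroup.intro M.add.subgroupI)
      (auto simp: minus gamma_simps single_uminus[symmetric] single_add[symmetric])
  then show ?thesis
    by (intro lie_submodule.intro lie_submodule_axioms.intro lie_module_axioms)
      (auto simp: kill gamma_simps intro: exI[of _ 0])
qed

text \<open>For every \<open>c\<close> the vector \<open>t^(-s)\<close> has weight 0, and its image
  in \<open>N\<close> is the required vector. Modules without weight 0 are thereby excluded.\<close>

lemma gamma_isomorphic_annihilated: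
  assumes N: "lie_module complex_field (witt_algebra scale \<phi>) N"
    and iso: "witt_isomorphic scale \<phi> (gamma \<phi> c (\<phi> s)) N"
  shows "\<exists>n\<in>carrier N. n \<noteq> \<zero>\<^bsub>N\<^esub> \<and> (\<forall>d. act N (Poly_Mapping.single 0 d) n = \<zero>\<^bsub>N\<^esub>)"
proof -
  have "\<exists>n\<in>carrier N. n \<noteq> \<zero>\<^bsub>N\<^esub> \<and> (\<forall>x\<in>range (Poly_Mapping.single 0). act N x n = \<zero>\<^bsub>N\<^esub>)"
  proof (rule lie_module_isomorphic_annihilated[OF gamma_lie_module[OF phi_linear] N iso])
    show "act (gamma \<phi> c (\<phi> s)) x (Poly_Mapping.single (- s) 1) = \<zero>\<^bsub>gamma \<phi> c (\<phi> s)\<^esub>"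
      if "x \<in> range (Poly_Mapping.single 0)" for x
      using that by (auto simp: gamma_simps gamma_act[OF phi_linear] phi_uminus)
  qed (simp_all add: gamma_simps single_eq_zero_iff)
  then show ?thesis
    by simp
qed

lemma gamma_not_isomorphic_gamma_infty:
  assumes ker: "Ker1 \<phi> = {0}"
  shows "\<not> witt_isomorphic scale \<phi> (gamma \<phi> c (\<phi> s)) (gamma_infty \<phi> s)"
proof
  assume "witt_isomorphic scale \<phi> (gamma \<phi> c (\<phi> s)) (gamma_infty \<phi> s)"
  from gamma_isomorphic_annihilated[OF gamma_infty_lie_module this]
  obtain f where f: "Poly_Mapping.keys f \<subseteq> {a. a \<noteq> - s}" "f \<noteq> 0"
    and ann: "\<And>d. act (gamma \<phi> 1 (\<phi> s)) (Poly_Mapping.single 0 d) f = 0"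
    by (auto simp: gamma_simps gamma_infty_def)
  \<comment> \<open>\<open>f\<close> has weight 0, which is the weight at \<open>- s\<close>; but
    the carrier of \<open>gamma_infty\<close> excludes \<open>t^(-s)\<close>.\<close>
  have "f = Poly_Mapping.single (- s) (Poly_Mapping.lookup f (- s))"
  proof (rule gamma_weight_space[OF ker phi_linear])
    show "act (gamma \<phi> 1 (\<phi> s)) (Poly_Mapping.single 0 d) f =
        Poly_Mapping.map ((*) (\<phi> (- s) d + \<phi> s d)) f" for d
      by (rule poly_mapping_eqI) (simp add: ann phi_uminus lookup_map_zero)
  qed
  moreover have "Poly_Mapping.lookup f (- s) = 0"
    using f(1) by (auto simp: in_keys_iff)
  ultimately show False
    using f(2) by simp
qed

lemma gamma_not_isomorphic_gamma_one:
  assumes ker: "Ker1 \<phi> = {0}"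
  shows "\<not> witt_isomorphic scale \<phi> (gamma \<phi> c (\<phi> s)) (gamma_one \<phi> s)"
proof
  let ?M = "gamma \<phi> 0 (\<phi> s)"
  define N :: "('g \<Rightarrow>\<^sub>0 complex) set" where "N = {Poly_Mapping.single (- s) z | z. True}"
  interpret N: lie_submodule complex_field "witt_algebra scale \<phi>" N ?M
    unfolding N_def by (rule gamma_one_submodule)
  have one: "gamma_one \<phi> s = quotient_lie_mod ?M N"
    by (simp only: gamma_one_def N_def)
  assume "witt_isomorphic scale \<phi> (gamma \<phi> c (\<phi> s)) (gamma_one \<phi> s)"
  from gamma_isomorphic_annihilated[OF gamma_one_lie_module this]
  obtain f where f: "N +>\<^bsub>?M\<^esub> f \<noteq> N"
    and ann: "\<And>d. act (quotient_lie_mod ?M N) (Poly_Mapping.single 0 d) (N +>\<^bsub>?M\<^esub> f) = N"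
    by (auto simp: gamma_simps one N.quotient_simps)
  have "N +>\<^bsub>?M\<^esub> act ?M (Poly_Mapping.single 0 d) f = N" for d
    using ann[of d] by (simp add: N.quotient_act gamma_simps)
  then have act_N: "act ?M (Poly_Mapping.single 0 d) f \<in> N" for d
    using N.a_rcos_self[of "act ?M (Poly_Mapping.single 0 d) f"] by (simp add: gamma_simps)
  \<comment> \<open>In the quotient \<open>f\<close> is killed only modulo \<open>N\<close>.
    Elements of \<open>N\<close> have coefficient 0 at \<open>a\<close>, and \<open>d\<close> is
    chosen so that the weight at \<open>a\<close> is nonzero on it.\<close>
  have "Poly_Mapping.lookup f a = 0" if a: "a \<noteq> - s" for a
  proof -
    obtain d where "\<phi> a d \<noteq> \<phi> (- s) d"
      using phi_separates[OF ker a] by blast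
    moreover have "Poly_Mapping.lookup (act ?M (Poly_Mapping.single 0 d) f) a = 0"
      using act_N[of d] a by (auto simp: N_def lookup_single)
    ultimately show ?thesis
      by (auto simp: lookup_gamma_act_zero[OF phi_linear] phi_uminus eq_neg_iff_add_eq_0)
  qed
  then have "f = Poly_Mapping.single (- s) (Poly_Mapping.lookup f (- s))"
    by (intro poly_mapping_eqI) (auto simp: lookup_single when_def)
  then have "f \<in> N"
    unfolding N_def by blast
  then show False
    using f N.a_rcos_const by blast
qed

text \<open>Weights do not separate these two modules. Instead the isomorphism is lifted to a map
  \<open>?h\<close> between \<open>gamma\<close> modules with parameters 0 and 1, which preserves
  the lines of the \<open>t^b\<close>, and a vector killed on one side only is found.\<close>

lemma gamma_one_not_isomorphic_gamma_infty:
  assumes compl: "complementary_subspaces scale U (Ker2 \<phi>)"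
    and ker: "Ker1 \<phi> = {0}"
    and inf: "infinite_dimensional scale U"
  shows "\<not> witt_isomorphic scale \<phi> (gamma_one \<phi> s) (gamma_infty \<phi> s)"
proof
  let ?M = "gamma \<phi> 0 (\<phi> s)"
  define N :: "('g \<Rightarrow>\<^sub>0 complex) set" where "N = {Poly_Mapping.single (- s) z | z. True}"
  interpret N: lie_submodule complex_field "witt_algebra scale \<phi>" N ?M
    unfolding N_def by (rule gamma_one_submodule)
  have one: "gamma_one \<phi> s = quotient_lie_mod ?M N"
    by (simp only: gamma_one_def N_def)
  assume "witt_isomorphic scale \<phi> (gamma_one \<phi> s) (gamma_infty \<phi> s)"
  then obtain f where f: "f \<in> witt_hom (gamma_one \<phi> s) (gamma_infty \<phi> s)"
    and bij: "bij_betw f (carrier (gamma_one \<phi> s)) (carrier (gamma_infty \<phi> s))"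
    unfolding lie_module_isomorphic_def by blast
  have "f \<in> witt_hom (gamma_one \<phi> s) (gamma \<phi> 1 (\<phi> s))"
    using f by (auto simp: lie_module_hom_def gamma_infty_def gamma_simps)
  from lie_module_hom_compose[OF N.quotient_map_hom this[unfolded one]]
  have h: "f \<circ> (\<lambda>m. N +>\<^bsub>?M\<^esub> m) \<in> witt_hom ?M (gamma \<phi> 1 (\<phi> s))" (is "?h \<in> _") .
  have h0: "?h 0 = 0"
    using lie_module_hom_zero[OF gamma_lie_module[OF phi_linear] gamma_lie_module[OF phi_linear] h]
    by (simp add: gamma_simps)
  obtain a :: 'g where a: "a \<noteq> 0"
    using group_nonzero by blast
  obtain y d where d: "\<phi> a d = 0" "\<phi> y d \<noteq> 0"
    using exists_independent[OF compl inf] by blast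
  \<comment> \<open>Chosen so that the weight of \<open>t^b\<close> is \<open>\<phi> a\<close>,
    which vanishes at \<open>d\<close>, while \<open>b \<noteq> - s\<close>.\<close>
  define b where "b = a - s"
  have b: "\<phi> b d + \<phi> s d = 0"
    using d(1) by (simp add: b_def phi_add[symmetric])
  obtain z where z: "?h (Poly_Mapping.single b 1) = Poly_Mapping.single b z"
    by (rule gamma_hom_single[OF ker phi_linear h])
  \<comment> \<open>With parameter \<open>k\<close>, \<open>t^y d\<close> sends \<open>t^b\<close>
    to \<open>k * \<phi> y d\<close> times \<open>t^(y+b)\<close>. This is zero for
    \<open>k = 0\<close> but not for \<open>k = 1\<close>, which forces
    \<open>z = 0\<close>.\<close>
  have "act ?M (Poly_Mapping.single y d) (Poly_Mapping.single b 1) = 0"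
    using b by (simp add: gamma_act[OF phi_linear])
  then have "act (gamma \<phi> 1 (\<phi> s)) (Poly_Mapping.single y d) (Poly_Mapping.single b z) = 0"
    using gamma_homD(2)[OF h, of "Poly_Mapping.single y d" "Poly_Mapping.single b 1"] h0 z by simp
  then have "\<phi> y d * z = 0"
    using b by (simp add: single_eq_zero_iff gamma_act[OF phi_linear])
  \<comment> \<open>Injectivity of \<open>f\<close> now puts \<open>t^b\<close> into
    \<open>N\<close>, which contradicts \<open>b \<noteq> - s\<close>.\<close>
  then have "f (N +>\<^bsub>?M\<^esub> Poly_Mapping.single b 1) = f (N +>\<^bsub>?M\<^esub> 0)"
    using d(2) z h0 by simp
  then have "N +>\<^bsub>?M\<^esub> Poly_Mapping.single b 1 = N +>\<^bsub>?M\<^esub> 0"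
    by (rule inj_onD[OF bij_betw_imp_inj_on[OF bij]]) (simp_all add: one N.quotient_simps gamma_simps)
  also have "\<dots> = N"
    using N.a_rcos_const[OF N.zero_closed] by (simp add: gamma_simps)
  finally have "Poly_Mapping.single b (1 :: complex) \<in> N"
    using N.a_rcos_self[of "Poly_Mapping.single b 1"] by (simp add: gamma_simps)
  then obtain w :: complex where w: "Poly_Mapping.single b 1 = Poly_Mapping.single (- s) w"
    unfolding N_def by blast
  have "b \<noteq> - s"
    using a by (simp add: b_def)
  then show False
    using arg_cong[OF w, of "\<lambda>g. Poly_Mapping.lookup g b"] by (simp add: lookup_single)
qed

end

theorem lemma3p11:
  fixes scale :: "complex \<Rightarrow> 'd::ab_group_add \<Rightarrow> 'd"
    and \<phi> :: "'g::ab_group_add \<Rightarrow> 'd \<Rightarrow> complex"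
    and Dbar :: "'d set"
    and \<sigma> :: "'d \<Rightarrow> complex"
    and c c' :: complex
  assumes "witt_datum scale \<phi>"
    and "complementary_subspaces scale Dbar (Ker2 \<phi>)"
    and "Ker1 \<phi> = {0}"
    and "infinite_dimensional scale Dbar"
    and "Vector_Spaces.linear scale (*) \<sigma>"
  shows "(witt_isomorphic scale \<phi> (gamma \<phi> c \<sigma>) (gamma \<phi> c' \<sigma>) \<longleftrightarrow> c = c') \<and>
    (\<forall>s. \<sigma> = \<phi> s \<longrightarrow>
       (\<forall>b b'. b \<noteq> b' \<longrightarrow> \<not> witt_isomorphic scale \<phi> (gamma \<phi> b \<sigma>) (gamma \<phi> b' \<sigma>)) \<and>
       (\<forall>b. \<not> witt_isomorphic scale \<phi> (gamma \<phi> b \<sigma>) (gamma_one \<phi> s)) \<and>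
       (\<forall>b. \<not> witt_isomorphic scale \<phi> (gamma \<phi> b \<sigma>) (gamma_infty \<phi> s)) \<and>
       \<not> witt_isomorphic scale \<phi> (gamma_one \<phi> s) (gamma_infty \<phi> s))"
proof -
  interpret witt_datum scale \<phi> by fact
  note eq = gamma_isomorphic_imp_eq[OF assms(2-4) assms(5)]
  show ?thesis
    using eq gamma_isomorphic_refl gamma_not_isomorphic_gamma_one[OF assms(3)]
      gamma_not_isomorphic_gamma_infty[OF assms(3)]
      gamma_one_not_isomorphic_gamma_infty[OF assms(2-4)]
    by blast
qed

end
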